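(* Let $G$ be a finite group acting on a finite set $\Omega$. If the action of $G$ on $\Omega$ is transitive and binary, then $r_\ell(G)\le r_2(G)^{\ell(\ell-1)/2}$ for each integer $\ell\ge 1$.
   Context: For an integer $\ell\ge 1$, $\Omega^{(\ell)}$ denotes the set of $\ell$-tuples $(\omega_1,\dots,\omega_\ell)\in\Omega^\ell$ with pairwise distinct entries, and $r_\ell(G)$ denotes the number of orbits of $G$ on $\Omega^{(\ell)}$ (acting coordinatewise). Binary: two $n$-tuples $I=(I_1,\dots,I_n)$, $J=(J_1,\dots,J_n)\in\Omega^n$ are called $r$-subtuple complete with respect to $G$ if for all $\{k_1,\dots,k_r\}\subseteq\{1,\dots,n\}$ there is $h\in G$ with $I_{k_i}^h=J_{k_i}$ for every $i\in\{1,\dots,r\}$. The action of $G$ on $\Omega$ is binary if, for every $n\ge 2$ and all $I,J\in\Omega^n$, $2$-subtuple completeness of $(I,J)$ implies the existence of a single $g\in G$ with $I_k^g=J_k$ for all $k\in\{1,\dots,n\}$. The convention $0^0=1$ is used. *)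

theory Defs
  imports "HOL-Algebra.Group_Action"
begin

text \<open>
  Tuples of length n over E are lists, so the index k of the literature (1 to n) is
  the list position k - 1.  Actions are left actions, as in \<^locale>\<open>group_action\<close>: the point written
  exponentially as x to the power g is \<^term>\<open>\<phi> g x\<close>.  Passing from a right action to the left
  action of the inverses changes none of the notions below.
\<close>

definition tuples :: "'b set \<Rightarrow> nat \<Rightarrow> 'b list set"
  where "tuples E n = {xs. length xs = n \<and> set xs \<subseteq> E}"

definition distinct_tuples :: "'b set \<Rightarrow> nat \<Rightarrow> 'b list set"
  where "distinct_tuples E n = {xs \<in> tuples E n. distinct xs}"

definition num_orbits_distinct ::
    "('a, 'm) monoid_scheme \<Rightarrow> 'b set \<Rightarrow> ('a \<Rightarrow> 'b \<Rightarrow> 'b) \<Rightarrow> nat \<Rightarrow> nat"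
  where "num_orbits_distinct G E \<phi> l = card (orbits G (distinct_tuples E l) (\<lambda>g. map (\<phi> g)))"

text \<open>
  The indices in ks need not be distinct.  For r at most the length of the tuples this
  agrees with quantifying over r-element sets of positions.
\<close>

definition subtuple_complete ::
    "('a, 'm) monoid_scheme \<Rightarrow> ('a \<Rightarrow> 'b \<Rightarrow> 'b) \<Rightarrow> nat \<Rightarrow> 'b list \<Rightarrow> 'b list \<Rightarrow> bool"
  where "subtuple_complete G \<phi> r I J \<longleftrightarrow>
    length I = length J \<and>
    (\<forall>ks. length ks = r \<and> set ks \<subseteq> {..<length I} \<longrightarrow>
      (\<exists>h \<in> carrier G. \<forall>k \<in> set ks. \<phi> h (I ! k) = J ! k))"

definition binary_action ::
    "('a, 'm) monoid_scheme \<Rightarrow> 'b set \<Rightarrow> ('a \<Rightarrow> 'b \<Rightarrow> 'b) \<Rightarrow> bool"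
  where "binary_action G E \<phi> \<longleftrightarrow>
    (\<forall>n \<ge> 2. \<forall>I \<in> tuples E n. \<forall>J \<in> tuples E n.
      subtuple_complete G \<phi> 2 I J \<longrightarrow>
      (\<exists>g \<in> carrier G. \<forall>k < n. \<phi> g (I ! k) = J ! k))"

end

theory Submission
  imports Defs
begin

text \<open>
  Label every pair of positions \<open>i < j\<close> of an \<open>l\<close>-tuple \<open>I\<close> of distinct points by the orbit of
  \<open>(I\<^sub>i, I\<^sub>j)\<close>.  Two tuples with equal labels are \<open>2\<close>-subtuple complete, so for a binary action they
  lie in one orbit (for \<open>l = 1\<close> transitivity takes over, as binarity says nothing there).  Hence an
  orbit of \<open>l\<close>-tuples is determined by a labelling of the \<open>l (l - 1) / 2\<close> pairs of positions, and
  each label is one of the \<open>r\<^sub>2\<close> orbits on pairs of distinct points.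
\<close>

text \<open>
  A quantity that is a function of another one takes at most as many values.  No well-defined map
  on orbits need be constructed: it suffices to compare the images of the set of tuples.
\<close>

lemma card_image_le_if_determined:
  assumes "finite (g ` A)"
    and "\<And>x y. x \<in> A \<Longrightarrow> y \<in> A \<Longrightarrow> g x = g y \<Longrightarrow> f x = f y"
  shows "card (f ` A) \<le> card (g ` A)"
proof -
  have "f ` A \<subseteq> (\<lambda>c. f (inv_into A g c)) ` (g ` A)"
  proof
    fix v assume "v \<in> f ` A"
    then obtain x where x: "x \<in> A" "v = f x" by blast
    have "f (inv_into A g (g x)) = f x"
      using x(1) by (intro assms(2)) (auto intro: inv_into_into f_inv_into_f)
    then show "v \<in> (\<lambda>c. f (inv_into A g c)) ` (g ` A)"
      using x by force
  qed
  then show ?thesis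
    using assms(1) by (rule surj_card_le[rotated])
qed

abbreviation tuple_orbit ::
    "('a, 'm) monoid_scheme \<Rightarrow> ('a \<Rightarrow> 'b \<Rightarrow> 'b) \<Rightarrow> 'b list \<Rightarrow> 'b list set"
  where "tuple_orbit G \<phi> \<equiv> orbit G (\<lambda>g. map (\<phi> g))"

text \<open>
  The usual argument with inverses and products is repeated here for tuples because the coordinatewise
  action is not an instance of \<^locale>\<open>group_action\<close>: its functions
  \<^term>\<open>map (\<phi> g)\<close> are not extensional on the tuples over \<^term>\<open>E\<close>.
\<close>

lemma (in group_action) tuple_orbit_eq_iff:
  assumes "set xs \<subseteq> E" and "set ys \<subseteq> E"
  shows "tuple_orbit G \<phi> xs = tuple_orbit G \<phi> ys \<longleftrightarrow> (\<exists>g \<in> carrier G. map (\<phi> g) xs = ys)"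
proof
  interpret group G using group_hom group_hom.axioms(1) by blast
  assume "tuple_orbit G \<phi> xs = tuple_orbit G \<phi> ys"
  moreover have "map (\<phi> \<one>\<^bsub>G\<^esub>) ys = ys"
  proof (rule map_idI)
    show "\<phi> \<one>\<^bsub>G\<^esub> y = y" if "y \<in> set ys" for y
      using that assms(2) by (metis id_eq_one restrict_apply' subsetD)
  qed
  then have "ys \<in> tuple_orbit G \<phi> ys"
    unfolding orbit_def by force
  ultimately have "ys \<in> tuple_orbit G \<phi> xs" by (simp only:)
  then show "\<exists>g \<in> carrier G. map (\<phi> g) xs = ys"
    unfolding orbit_def by blast
next
  interpret group G using group_hom group_hom.axioms(1) by blast
  assume "\<exists>g \<in> carrier G. map (\<phi> g) xs = ys"
  then obtain g where g: "g \<in> carrier G" "map (\<phi> g) xs = ys" by blast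
  have shift: "map (\<phi> h) (map (\<phi> k) zs) = map (\<phi> (h \<otimes>\<^bsub>G\<^esub> k)) zs"
    if "h \<in> carrier G" "k \<in> carrier G" "set zs \<subseteq> E" for h k zs
    using that composition_rule by (auto simp: subset_iff)
  have "map (\<phi> h) ys \<in> tuple_orbit G \<phi> xs" if "h \<in> carrier G" for h
    using shift[OF that g(1) assms(1)] g that unfolding orbit_def by auto
  moreover have "map (\<phi> h) xs \<in> tuple_orbit G \<phi> ys" if "h \<in> carrier G" for h
  proof -
    have "map (\<phi> (h \<otimes>\<^bsub>G\<^esub> inv\<^bsub>G\<^esub> g)) ys = map (\<phi> (h \<otimes>\<^bsub>G\<^esub> inv\<^bsub>G\<^esub> g \<otimes>\<^bsub>G\<^esub> g)) xs"
      using shift[OF _ g(1) assms(1)] g that by auto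
    also have "\<dots> = map (\<phi> h) xs"
      using g(1) that by (simp add: m_assoc)
    finally have "map (\<phi> h) xs = map (\<phi> (h \<otimes>\<^bsub>G\<^esub> inv\<^bsub>G\<^esub> g)) ys" ..
    moreover have "h \<otimes>\<^bsub>G\<^esub> inv\<^bsub>G\<^esub> g \<in> carrier G"
      using g(1) that by simp
    ultimately show ?thesis
      unfolding orbit_def by blast
  qed
  ultimately show "tuple_orbit G \<phi> xs = tuple_orbit G \<phi> ys"
    unfolding orbit_def by blast
qed

text \<open>
  The larger position comes first, so that the pairs form a dependent sum with fibres of size \<open>j\<close>.
\<close>

abbreviation position_pairs :: "nat \<Rightarrow> (nat \<times> nat) set"
  where "position_pairs l \<equiv> SIGMA j:{..<l}. {..<j}"

lemma card_position_pairs: "card (position_pairs l) = l * (l - 1) div 2"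
proof -
  have "card (position_pairs l) = \<Sum>{0..<l}"
    by (simp add: lessThan_atLeast0)
  then show ?thesis
    by (simp add: Sum_Ico_nat)
qed

text \<open>
  Restricting the labelling to the pairs of positions makes it an element of a finite function space,
  so that labellings can be counted.
\<close>

definition pair_labels ::
    "('a, 'm) monoid_scheme \<Rightarrow> ('a \<Rightarrow> 'b \<Rightarrow> 'b) \<Rightarrow> nat \<Rightarrow> 'b list \<Rightarrow> nat \<times> nat \<Rightarrow> 'b list set"
  where "pair_labels G \<phi> l I = (\<lambda>(j, i) \<in> position_pairs l. tuple_orbit G \<phi> [I ! i, I ! j])"

text \<open>
  Subtuple completeness also concerns a position repeated, which carries no label; there the
  element of the group is provided by transitivity.
\<close>

lemma (in transitive_action) subtuple_complete_if_pair_labels_eq: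
  assumes I: "I \<in> tuples E l" and J: "J \<in> tuples E l"
    and eq: "pair_labels G \<phi> l I = pair_labels G \<phi> l J"
  shows "subtuple_complete G \<phi> 2 I J"
proof -
  have mem: "I ! k \<in> E" "J ! k \<in> E" if "k < l" for k
    using I J that by (auto simp: tuples_def)
  have single: "\<exists>h \<in> carrier G. \<phi> h (I ! k) = J ! k" if "k < l" for k
    using unique_orbit mem that by blast
  have pair: "\<exists>h \<in> carrier G. \<phi> h (I ! i) = J ! i \<and> \<phi> h (I ! j) = J ! j" if "i < j" "j < l" for i j
  proof -
    have "tuple_orbit G \<phi> [I ! i, I ! j] = tuple_orbit G \<phi> [J ! i, J ! j]"
      using fun_cong[OF eq, of "(j, i)"] that by (simp add: pair_labels_def)
    then show ?thesis
      using tuple_orbit_eq_iff[of "[I ! i, I ! j]" "[J ! i, J ! j]"] mem that by auto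
  qed
  have "\<exists>h \<in> carrier G. \<phi> h (I ! a) = J ! a \<and> \<phi> h (I ! b) = J ! b" if "a < l" "b < l" for a b
    using single[of a] pair[of a b] pair[of b a] that by (cases a b rule: linorder_cases) auto
  then show ?thesis
    using I J by (auto simp: subtuple_complete_def tuples_def length_Suc_conv numeral_2_eq_2)
qed

lemma (in transitive_action) tuple_orbit_eq_if_pair_labels_eq:
  assumes "binary_action G E \<phi>"
    and I: "I \<in> tuples E l" and J: "J \<in> tuples E l"
    and eq: "pair_labels G \<phi> l I = pair_labels G \<phi> l J"
  shows "tuple_orbit G \<phi> I = tuple_orbit G \<phi> J"
proof -
  have complete: "subtuple_complete G \<phi> 2 I J"
    using subtuple_complete_if_pair_labels_eq[OF I J eq] .
  have len: "length I = l" "length J = l" and sub: "set I \<subseteq> E" "set J \<subseteq> E"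
    using I J by (auto simp: tuples_def)
  consider "l = 0" | "l = 1" | "l \<ge> 2" by linarith
  then have "\<exists>g \<in> carrier G. map (\<phi> g) I = J"
  proof cases
    case 1
    then show ?thesis
      using len group.is_monoid group_hom group_hom.axioms(1) monoid.one_closed by fastforce
  next
    case 2
    \<comment> \<open>Binarity starts at length \<open>2\<close>, but repeating the only position gives an index list of length \<open>2\<close>.\<close>
    have "\<exists>h \<in> carrier G. \<phi> h (I ! 0) = J ! 0"
      using complete[unfolded subtuple_complete_def, THEN conjunct2, THEN spec, of "[0, 0]"] 2 len
      by auto
    then show ?thesis
      using 2 len by (auto simp: list_eq_iff_nth_eq)
  next
    case 3
    then have "\<exists>g \<in> carrier G. \<forall>k < l. \<phi> g (I ! k) = J ! k"
      using assms(1) I J complete unfolding binary_action_def by blast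
    then show ?thesis
      using len by (metis length_map nth_equalityI nth_map)
  qed
  then show ?thesis
    using tuple_orbit_eq_iff[OF sub] by blast
qed

lemma finite_distinct_tuples: "finite E \<Longrightarrow> finite (distinct_tuples E n)"
  by (rule finite_subset[OF _ finite_lists_length_eq[of E n]])
    (auto simp: distinct_tuples_def tuples_def)

lemma orbits_eq_image: "orbits G E \<psi> = orbit G \<psi> ` E"
  by (auto simp: orbits_def)

lemma pair_labels_in_PiE:
  assumes "I \<in> distinct_tuples E l"
  shows "pair_labels G \<phi> l I \<in>
    position_pairs l \<rightarrow>\<^sub>E orbits G (distinct_tuples E 2) (\<lambda>g. map (\<phi> g))"
proof -
  have "[I ! i, I ! j] \<in> distinct_tuples E 2" if "i < j" "j < l" for i j
    using assms that by (auto simp: distinct_tuples_def tuples_def nth_eq_iff_index_eq)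
  then show ?thesis
    by (auto simp: pair_labels_def orbits_eq_image)
qed

theorem lemma2p7:
  fixes G :: "('a, 'm) monoid_scheme" and \<Omega> :: "'b set"
    and \<phi> :: "'a \<Rightarrow> 'b \<Rightarrow> 'b" and l :: nat
  assumes "finite (carrier G)" and "finite \<Omega>"
    and "transitive_action G \<Omega> \<phi>"
    and "binary_action G \<Omega> \<phi>"
    and "l \<ge> 1"
  shows "num_orbits_distinct G \<Omega> \<phi> l \<le> num_orbits_distinct G \<Omega> \<phi> 2 ^ (l * (l - 1) div 2)"
proof -
  interpret transitive_action G \<Omega> \<phi> by fact
  let ?D = "distinct_tuples \<Omega>"
  let ?R = "orbits G (?D 2) (\<lambda>g. map (\<phi> g))"
  let ?labellings = "position_pairs l \<rightarrow>\<^sub>E ?R"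
  have fin: "finite ?labellings"
    using finite_distinct_tuples[OF assms(2)] by (intro finite_PiE) (auto simp: orbits_eq_image)
  have labels: "pair_labels G \<phi> l ` ?D l \<subseteq> ?labellings"
    by (intro image_subsetI pair_labels_in_PiE)
  have "num_orbits_distinct G \<Omega> \<phi> l = card (tuple_orbit G \<phi> ` ?D l)"
    by (simp add: num_orbits_distinct_def orbits_eq_image)
  also have "\<dots> \<le> card (pair_labels G \<phi> l ` ?D l)"
    using tuple_orbit_eq_if_pair_labels_eq[OF assms(4)] finite_subset[OF labels fin]
    by (intro card_image_le_if_determined) (auto simp: distinct_tuples_def)
  also have "\<dots> \<le> card ?labellings"
    using fin labels by (rule card_mono)
  also have "\<dots> = card ?R ^ card (position_pairs l)"
    by (intro card_funcsetE) auto
  also have "\<dots> = num_orbits_distinct G \<Omega> \<phi> 2 ^ (l * (l - 1) div 2)"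
    by (simp only: card_position_pairs num_orbits_distinct_def)
  finally show ?thesis .
qed

end
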